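(* Let $\mathcal{H}$ be a finite-dimensional real Hilbert space, $n\geq1$ an integer and $L>0$. Let $A_1,\dots,A_n\colon\mathcal{H}\rightrightarrows\mathcal{H}$ be maximally monotone operators and let $B_1,\dots,B_n\colon\mathcal{H}\to\mathcal{H}$ be monotone and $L$-Lipschitz continuous. Suppose the inclusion $$0\in\sum_{i=1}^n(A_i+B_i)(x)\subset\mathcal{H}\qquad (I)$$ has at least one solution. Let $W\colon\mathcal{H}^n\to\mathcal{H}^n$ be a linear operator satisfying $W=W^*$, $\ker(\mathrm{Id}-W)=\mathcal{D}$ and $\mathrm{Id}\succeq W\succ-\mathrm{Id}$, and suppose $$0<\tau<\frac{1+\lambda_{\min}(W)}{4L}.$$ Let $\mathbf{x}^0=\mathbf{x}^{-1}\in\mathcal{H}^n$ be arbitrary, set $\mathbf{v}^k=2\mathbf{B}(\mathbf{x}^k)-\mathbf{B}(\mathbf{x}^{k-1})$ for $k\geq0$, and define $(\mathbf{x}^k)$ by $$\mathbf{u}^1=\mathbf{x}^0-\tau\mathbf{B}(\mathbf{x}^0),\qquad \mathbf{x}^1=J_{\tau\mathbf{A}}(\mathbf{u}^1),$$ and, for $k\geq1$, $$\mathbf{u}^{k+1}=W\mathbf{x}^k+\mathbf{u}^k-\tfrac12(\mathrm{Id}+W)\mathbf{x}^{k-1}-\tau(\mathbf{v}^k-\mathbf{v}^{k-1}),\qquad \mathbf{x}^{k+1}=J_{\tau\mathbf{A}}(\mathbf{u}^{k+1}).$$ Then the sequence $(\mathbf{x}^k)$ converges to a point $\mathbf{x}=(x,\dots,x)\in\mathcal{H}^n$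 such that $x$ is a solution of $(I)$.
   Context: $\mathcal{H}^n=\{(x_1,\dots,x_n):x_i\in\mathcal{H}\}$ with the product Hilbert space structure, and $\mathcal{D}=\{\mathbf{x}\in\mathcal{H}^n: x_1=\dots=x_n\}$ is the diagonal subspace. For $\mathbf{x}=(x_1,\dots,x_n)\in\mathcal{H}^n$: $\mathbf{A}(\mathbf{x})=A_1(x_1)\times\dots\times A_n(x_n)$ and $\mathbf{B}(\mathbf{x})=(B_1(x_1),\dots,B_n(x_n))$. A set-valued operator $A$ is monotone if $\langle x-u,y-v\rangle\geq0$ for all $y\in A(x)$, $v\in A(u)$, and maximally monotone if no monotone operator properly extends it. The resolvent is $J_A=(\mathrm{Id}+A)^{-1}$, single-valued with full domain when $A$ is maximally monotone. $\mathrm{Id}\succeq W\succ-\mathrm{Id}$ means $\mathrm{Id}-W$ is positive semidefinite and $W+\mathrm{Id}$ is positive definite. $\lambda_{\min}(W)$ is the smallest eigenvalue of $W$. *)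

theory Defs
  imports "HOL-Analysis.Analysis" "HOL-Library.Set_Algebras"
begin

text \<open>A set-valued operator on \<^term>\<open>H\<close> is a function of type \<^typ>\<open>'a \<Rightarrow> 'a set\<close>; a single-valued
  operator \<^term>\<open>B\<close> is identified with \<^term>\<open>\<lambda>x. {B x}\<close>. The space \<^term>\<open>H\<close>, of finite dimension
  at least 1, is a type of class \<^class>\<open>euclidean_space\<close>, and its \<^term>\<open>n\<close>-th power is the type
  \<^typ>\<open>('a, 'n) vec\<close>, whose library inner product is the sum of the componentwise ones.\<close>

definition monotone_operator :: "('a::real_inner \<Rightarrow> 'a set) \<Rightarrow> bool" where
  "monotone_operator A \<longleftrightarrow> (\<forall>x u. \<forall>y\<in>A x. \<forall>v\<in>A u. inner (x - u) (y - v) \<ge> 0)"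

definition maximally_monotone :: "('a::real_inner \<Rightarrow> 'a set) \<Rightarrow> bool" where
  "maximally_monotone A \<longleftrightarrow>
     monotone_operator A \<and>
     (\<forall>A'. monotone_operator A' \<and> (\<forall>x. A x \<subseteq> A' x) \<longrightarrow> A' = A)"

definition scale_operator :: "real \<Rightarrow> ('a::real_vector \<Rightarrow> 'a set) \<Rightarrow> 'a \<Rightarrow> 'a set" where
  "scale_operator t A x = (\<lambda>y. t *\<^sub>R y) ` A x"

definition inverse_operator :: "('a \<Rightarrow> 'a set) \<Rightarrow> 'a \<Rightarrow> 'a set" where
  "inverse_operator A u = {x. u \<in> A x}"

text \<open>\<^term>\<open>{x} + A x\<close> is the Minkowski sum. For maximally monotone \<^term>\<open>A\<close> the set
  \<^term>\<open>inverse_operator (\<lambda>x. {x} + A x) u\<close> is a singleton for every \<^term>\<open>u\<close> (Minty), and the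
  resolvent is the resulting function.\<close>

definition resolvent :: "('a::real_vector \<Rightarrow> 'a set) \<Rightarrow> 'a \<Rightarrow> 'a" where
  "resolvent A u = the_elem (inverse_operator (\<lambda>x. {x} + A x) u)"

definition product_operator :: "('n \<Rightarrow> 'a \<Rightarrow> 'a set) \<Rightarrow> 'a ^ 'n \<Rightarrow> ('a ^ 'n) set" where
  "product_operator A x = {y. \<forall>i. y $ i \<in> A i (x $ i)}"

definition product_map :: "('n \<Rightarrow> 'a \<Rightarrow> 'a) \<Rightarrow> 'a ^ 'n \<Rightarrow> 'a ^ 'n" where
  "product_map B x = (\<chi> i. B i (x $ i))"

definition diagonal :: "('a ^ 'n) set" where
  "diagonal = {x. \<forall>i j. x $ i = x $ j}"

text \<open>The sum over \<^term>\<open>i\<close> is a Minkowski sum of sets.\<close>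

definition solves_inclusion ::
    "('n::finite \<Rightarrow> 'a::real_vector \<Rightarrow> 'a set) \<Rightarrow> ('n \<Rightarrow> 'a \<Rightarrow> 'a) \<Rightarrow> 'a \<Rightarrow> bool" where
  "solves_inclusion A B x \<longleftrightarrow> 0 \<in> (\<Sum>i\<in>UNIV. A i x + {B i x})"

text \<open>Symmetry is not part of the next two definitions; they are applied to
  \<^term>\<open>\<lambda>x. x - W x\<close> and \<^term>\<open>\<lambda>x. W x + x\<close> with \<^term>\<open>W\<close> self-adjoint.\<close>

definition positive_semidefinite :: "('a::real_inner \<Rightarrow> 'a) \<Rightarrow> bool" where
  "positive_semidefinite T \<longleftrightarrow> (\<forall>x. inner (T x) x \<ge> 0)"

definition positive_definite :: "('a::real_inner \<Rightarrow> 'a) \<Rightarrow> bool" where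
  "positive_definite T \<longleftrightarrow> (\<forall>x. x \<noteq> 0 \<longrightarrow> inner (T x) x > 0)"

definition is_eigenvalue :: "('a::real_vector \<Rightarrow> 'a) \<Rightarrow> real \<Rightarrow> bool" where
  "is_eigenvalue T l \<longleftrightarrow> (\<exists>v. v \<noteq> 0 \<and> T v = l *\<^sub>R v)"

definition lambda_min :: "('a::real_vector \<Rightarrow> 'a) \<Rightarrow> real" where
  "lambda_min T = (LEAST l. is_eigenvalue T l)"

end

theory Submission imports Defs begin

text \<open>Put \<open>S = (Id - W) / 2\<close>, a positive semidefinite operator whose kernel is the diagonal. Summing
  the recursion for \<open>u\<close> shows that the algorithm is a primal-dual method in disguise: with
  \<open>r\<^sup>0 = - x\<^sup>0\<close> and \<open>r\<^sup>k\<^sup>+\<^sup>1 = r\<^sup>k + x\<^sup>k\<^sup>+\<^sup>1\<close> one has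
  \<open>u\<^sup>k\<^sup>+\<^sup>1 = x\<^sup>k - S (r\<^sup>k + x\<^sup>k) - \<tau> v\<^sup>k\<close>. Its fixed points are pairs \<open>(x, r)\<close> with
  \<open>S x = 0\<close> and \<open>- S r - \<tau> B x \<in> \<tau> A x\<close>. Since \<open>range S\<close> is the orthogonal complement of the
  diagonal, such pairs correspond to vectors \<open>x = (z, ..., z)\<close> with \<open>z\<close> a solution of the inclusion.

  In the metric \<open>\<langle>(Id - S) x, x\<rangle> + \<langle>S r, r\<rangle>\<close> the step is a forward-reflected-backward step. The
  distance to a fixed point, corrected by terms for the reflection, is a Lyapunov function
  (\<open>lyapunov_decrease\<close>). The correction terms are controlled as soon as \<open>2 \<tau> L\<close> is smaller than the
  coercivity constant of \<open>Id - S = (Id + W) / 2\<close>; this constant is \<open>(1 + \<lambda>\<^sub>m\<^sub>i\<^sub>n(W)) / 2\<close> by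
  \<open>lambda_min_le_form\<close>, whence the bound on \<open>\<tau>\<close>. Bounded iterates and vanishing increments
  give a limit point that is again a fixed point, and the Lyapunov function belonging to it
  forces convergence of the whole sequence (\<open>convergence\<close>).

  The resolvent is a definite description, so that its defining property rests on \<open>Minty\<close>'s theorem:
  \<open>Id + A\<close> is surjective for maximally monotone \<open>A\<close>. In finite dimension this follows from
  compactness and a dual convex minimisation problem for finite monotone families
  (\<open>finite_monotone_extension_at_negative\<close>).\<close>

section \<open>Maximally monotone operators and Minty's theorem\<close>

lemma monotone_operatorD:
  assumes "monotone_operator A" "y \<in> A x" "v \<in> A u"
  shows "inner (x - u) (y - v) \<ge> 0"
  using assms unfolding monotone_operator_def by blast

text \<open>Otherwise adding the pair \<open>(x, w)\<close> to the graph would give a proper monotone extension.\<close>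

lemma maximally_monotoneD:
  assumes "maximally_monotone A"
    and rel: "\<And>z y. y \<in> A z \<Longrightarrow> inner (z - x) (y - w) \<ge> 0"
  shows "w \<in> A x"
proof -
  define A' where "A' z = (if z = x then insert w (A z) else A z)" for z
  have mono: "monotone_operator A"
    using assms(1) by (simp add: maximally_monotone_def)
  have flip: "inner (x - z) (w - y) = inner (z - x) (y - w)" for y z
    by (simp add: inner_diff_left inner_diff_right)
  have "monotone_operator A'"
    unfolding monotone_operator_def A'_def
    using rel monotone_operatorD[OF mono] by (auto simp: flip)
  moreover have "A z \<subseteq> A' z" for z
    by (auto simp: A'_def)
  ultimately have "A' = A"
    using assms(1) by (simp add: maximally_monotone_def)
  moreover have "w \<in> A' x"
    by (simp add: A'_def)
  ultimately show ?thesis by simp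
qed

lemma maximally_monotoneI:
  assumes "monotone_operator A"
    and "\<And>x w. (\<And>z y. y \<in> A z \<Longrightarrow> inner (z - x) (y - w) \<ge> 0) \<Longrightarrow> w \<in> A x"
  shows "maximally_monotone A"
  unfolding maximally_monotone_def
proof (intro conjI allI impI assms(1))
  fix A' assume A': "monotone_operator A' \<and> (\<forall>x. A x \<subseteq> A' x)"
  have "A' x \<subseteq> A x" for x
  proof
    fix w assume "w \<in> A' x"
    then show "w \<in> A x"
      using A' monotone_operatorD[of A'] by (intro assms(2)) blast
  qed
  with A' show "A' = A" by blast
qed

lemma mem_scale_operator_iff:
  assumes "t \<noteq> 0"
  shows "y \<in> scale_operator t A x \<longleftrightarrow> (1 / t) *\<^sub>R y \<in> A x"
proof
  assume "(1 / t) *\<^sub>R y \<in> A x"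
  then have "t *\<^sub>R ((1 / t) *\<^sub>R y) \<in> scale_operator t A x"
    unfolding scale_operator_def by blast
  then show "y \<in> scale_operator t A x"
    using assms by simp
qed (use assms in \<open>auto simp: scale_operator_def\<close>)

lemma monotone_operator_scale:
  assumes "monotone_operator A" "t \<ge> 0"
  shows "monotone_operator (scale_operator t A)"
  using assms
  by (auto simp: monotone_operator_def scale_operator_def simp flip: scaleR_diff_right)

lemma maximally_monotone_scale:
  assumes "maximally_monotone A" "t > 0"
  shows "maximally_monotone (scale_operator t A)"
proof (rule maximally_monotoneI)
  show "monotone_operator (scale_operator t A)"
    using assms by (intro monotone_operator_scale) (auto simp: maximally_monotone_def)
  fix x w
  assume rel: "\<And>z y. y \<in> scale_operator t A z \<Longrightarrow> inner (z - x) (y - w) \<ge> 0"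
  have "(1 / t) *\<^sub>R w \<in> A x"
  proof (rule maximally_monotoneD[OF assms(1)])
    fix z y assume "y \<in> A z"
    then have "0 \<le> inner (z - x) (t *\<^sub>R y - w)"
      by (intro rel) (auto simp: scale_operator_def)
    also have "t *\<^sub>R y - w = t *\<^sub>R (y - (1 / t) *\<^sub>R w)"
      using assms(2) by (simp add: scaleR_diff_right)
    finally show "inner (z - x) (y - (1 / t) *\<^sub>R w) \<ge> 0"
      using assms(2) by (simp add: zero_le_mult_iff)
  qed
  then show "w \<in> scale_operator t A x"
    using assms(2) by (simp add: mem_scale_operator_iff)
qed

lemma maximally_monotone_closed_graph:
  assumes "maximally_monotone A"
    and "a \<longlonglongrightarrow> x" "b \<longlonglongrightarrow> w" "\<And>j::nat. b j \<in> A (a j)"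
  shows "w \<in> A x"
proof (rule maximally_monotoneD[OF assms(1)])
  fix z y assume "y \<in> A z"
  then have "inner (z - a j) (y - b j) \<ge> 0" for j
    using assms(1,4) by (auto simp: maximally_monotone_def monotone_operator_def)
  moreover have "(\<lambda>j. inner (z - a j) (y - b j)) \<longlonglongrightarrow> inner (z - x) (y - w)"
    by (intro tendsto_intros assms)
  ultimately show "inner (z - x) (y - w) \<ge> 0"
    by (simp add: LIMSEQ_le_const)
qed

lemma nonneg_slope_of_nonneg_quadratic:
  fixes d e :: real
  assumes "\<And>t. 0 < t \<Longrightarrow> t \<le> 1 \<Longrightarrow> 0 \<le> t * d + t\<^sup>2 * e"
  shows "0 \<le> d"
proof (rule tendsto_lowerbound)
  have "((\<lambda>t. d + t * e) \<longlongrightarrow> d + 0 * e) (at_right 0)"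
    by (intro tendsto_intros)
  then show "((\<lambda>t. d + t * e) \<longlongrightarrow> d) (at_right 0)"
    by simp
  have "0 \<le> d + t * e" if "0 < t" "t \<le> 1" for t
  proof -
    have "0 \<le> t * (d + t * e)"
      using assms[OF that] by (simp add: algebra_simps power2_eq_square)
    then show ?thesis
      using that by (simp add: zero_le_mult_iff)
  qed
  then show "\<forall>\<^sub>F t in at_right 0. 0 \<le> d + t * e"
    unfolding eventually_at_right_field by (intro exI[of _ 1]) auto
qed simp

text \<open>The function \<open>(z, y) \<mapsto> \<langle>z, y\<rangle>\<close> satisfies Jensen's inequality on a monotone set, because
  monotonicity of a pair of points is an inequality that is affine in each of the two lifted points
  \<open>(z, y, \<langle>z, y\<rangle>)\<close> separately: it therefore passes to the convex hull first in one of them, then in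
  the other.\<close>

lemma inner_le_on_convex_hull_of_monotone:
  fixes G :: "('a::real_inner \<times> 'a) set"
  assumes mono: "\<And>z y z' y'. (z, y) \<in> G \<Longrightarrow> (z', y') \<in> G \<Longrightarrow> inner (z - z') (y - y') \<ge> 0"
    and p: "(Z, Y, b) \<in> convex hull ((\<lambda>(z, y). (z, y, inner z y)) ` G)"
  shows "inner Z Y \<le> b"
proof -
  define P where "P = (\<lambda>(z::'a, y::'a). (z, y, inner z y)) ` G"
  define H :: "'a \<Rightarrow> 'a \<Rightarrow> real \<Rightarrow> ('a \<times> 'a \<times> real) set"
    where "H z y c = {p. inner (- y, - z, 1) p \<ge> - c}" for z y c
  have H: "(z', y', c') \<in> H z y c \<longleftrightarrow> inner z' y + inner z y' \<le> c' + c" for z y z' y' :: 'a and c c' :: real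
    by (auto simp: H_def inner_commute)
  have conv: "convex (H z y c)" for z y c
    unfolding H_def by (rule convex_halfspace_ge)
  have *: "convex hull P \<subseteq> H z y (inner z y)" if "(z, y) \<in> G" for z y
  proof (rule hull_minimal)
    show "P \<subseteq> H z y (inner z y)"
    proof (clarsimp simp: P_def H)
      fix z' y' assume "(z', y') \<in> G"
      from mono[OF that this]
      show "inner z' y + inner z y' \<le> inner z' y' + inner z y"
        by (simp add: inner_diff_left inner_diff_right)
    qed
  qed (rule conv)
  have Zb: "(Z, Y, b) \<in> convex hull P"
    using p by (simp add: P_def)
  have "convex hull P \<subseteq> H Z Y b"
  proof (rule hull_minimal)
    show "P \<subseteq> H Z Y b"
    proof (clarsimp simp: P_def H)
      fix z y assume "(z, y) \<in> G"
      from *[OF this] Zb have "(Z, Y, b) \<in> H z y (inner z y)" by blast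
      then show "inner z Y + inner Z y \<le> inner z y + b"
        by (simp add: H)
    qed
  qed (rule conv)
  with Zb have "(Z, Y, b) \<in> H Z Y b" by blast
  then show ?thesis by (simp add: H)
qed

text \<open>The point sought comes from the dual problem: minimise the convex function
  \<open>\<parallel>Z - Y\<parallel>\<^sup>2 / 4 + b\<close> over the convex hull of the lifted points \<open>(z, y, \<langle>z, y\<rangle>)\<close> and take
  \<open>x = (Z - Y) / 2\<close> at a minimiser. The first-order condition in the direction of a point of the
  family bounds \<open>\<langle>z - x, y + x\<rangle>\<close> below by the minimum, which is at least
  \<open>\<parallel>Z + Y\<parallel>\<^sup>2 / 4\<close> by the preceding Jensen inequality.\<close>

lemma finite_monotone_extension_at_negative:
  fixes G :: "('a::euclidean_space \<times> 'a) set"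
  assumes "finite G"
    and mono: "\<And>z y z' y'. (z, y) \<in> G \<Longrightarrow> (z', y') \<in> G \<Longrightarrow> inner (z - z') (y - y') \<ge> 0"
  shows "\<exists>x. \<forall>(z, y)\<in>G. inner (z - x) (y + x) \<ge> 0"
proof (cases "G = {}")
  case False
  define C where "C = convex hull ((\<lambda>(z, y). (z, y, inner z y)) ` G)"
  define f :: "'a \<times> 'a \<times> real \<Rightarrow> real"
    where "f p = (norm (fst p - fst (snd p)))\<^sup>2 / 4 + snd (snd p)" for p
  have "compact C"
    unfolding C_def using assms(1) by (intro finite_imp_compact_convex_hull) auto
  moreover have "C \<noteq> {}"
    using False by (simp add: C_def)
  moreover have "continuous_on C f"
    unfolding f_def by (intro continuous_intros) auto
  ultimately obtain p where p: "p \<in> C" "\<And>q. q \<in> C \<Longrightarrow> f p \<le> f q"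
    using continuous_attains_inf by metis
  obtain Z Y b where pZ: "p = (Z, Y, b)" by (cases p)
  define x where "x = (1 / 2) *\<^sub>R (Z - Y)"
  have "inner (z - x) (y + x) \<ge> 0" if zy: "(z, y) \<in> G" for z y
  proof -
    define q where "q = (z, y, inner z y)"
    have q: "q \<in> C"
      unfolding C_def q_def using zy by (intro hull_inc) force
    define a e where "a = Z - Y" and "e = (z - y) - (Z - Y)"
    define d where "d = inner a e / 2 + (inner z y - b)"
    have "0 \<le> d"
    proof (rule nonneg_slope_of_nonneg_quadratic)
      fix t :: real assume t: "0 < t" "t \<le> 1"
      have "(1 - t) *\<^sub>R p + t *\<^sub>R q \<in> C"
        using p(1) q t by (intro convexD) (auto simp: C_def)
      from p(2)[OF this] have "f p \<le> f ((1 - t) *\<^sub>R p + t *\<^sub>R q)" .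
      also have "\<dots> = (norm (a + t *\<^sub>R e))\<^sup>2 / 4 + ((1 - t) * b + t * inner z y)"
        by (simp add: f_def pZ q_def a_def e_def algebra_simps)
      also have "\<dots> = f p + t * d + t\<^sup>2 * ((norm e)\<^sup>2 / 4)"
        unfolding power2_norm_eq_inner
        by (simp add: f_def pZ d_def a_def[symmetric] inner_add_left inner_add_right
            inner_commute[of e a] power2_norm_eq_inner power2_eq_square[of t] field_simps)
      finally show "0 \<le> t * d + t\<^sup>2 * ((norm e)\<^sup>2 / 4)"
        by simp
    qed
    moreover have "inner Z Y \<le> b"
      using inner_le_on_convex_hull_of_monotone[OF mono] p(1) pZ by (simp add: C_def)
    moreover have "inner (z - x) (y + x)
        = d + (b - inner Z Y) + (norm (Z + Y))\<^sup>2 / 4"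
      by (simp add: x_def d_def a_def e_def power2_norm_eq_inner algebra_simps inner_commute
          add_divide_distrib diff_divide_distrib)
    ultimately show ?thesis by simp
  qed
  then show ?thesis by blast
qed auto

text \<open>Each condition \<open>\<langle>z - x, y + x\<rangle> \<ge> 0\<close> confines \<open>x\<close> to a closed ball, so compactness reduces
  the existence of \<open>x\<close> to finitely many pairs. The point found is related monotonically to the
  whole graph of \<open>A - u\<close>, and maximality turns this into membership.\<close>

theorem Minty:
  fixes A :: "'a::euclidean_space \<Rightarrow> 'a set"
  assumes "maximally_monotone A"
  shows "\<exists>x. u - x \<in> A x"
proof -
  define G where "G = {(z, y - u) | z y. y \<in> A z}"
  have mono: "inner (z - z') (y - y') \<ge> 0" if "(z, y) \<in> G" "(z', y') \<in> G" for z y z' y'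
    using that assms by (auto simp: G_def maximally_monotone_def monotone_operator_def)
  define K where "K = (\<lambda>(z, y). cball ((1 / 2) *\<^sub>R (z - y)) (norm (z + y) / 2) :: 'a set)"
  have K: "x \<in> K (z, y) \<longleftrightarrow> inner (z - x) (y + x) \<ge> 0" for x z y
  proof -
    have "x \<in> K (z, y) \<longleftrightarrow> (norm (x - (1 / 2) *\<^sub>R (z - y)))\<^sup>2 \<le> (norm (z + y) / 2)\<^sup>2"
      by (simp add: K_def dist_norm norm_minus_commute flip: abs_le_square_iff)
    also have "(norm (z + y) / 2)\<^sup>2 = (norm (x - (1 / 2) *\<^sub>R (z - y)))\<^sup>2 + inner (z - x) (y + x)"
      by (simp add: power_divide power2_norm_eq_inner algebra_simps inner_commute
          add_divide_distrib diff_divide_distrib)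
    finally show ?thesis by simp
  qed
  have "\<exists>x. \<forall>p\<in>G. x \<in> K p"
  proof (cases "G = {}")
    case False
    then obtain p0 where p0: "p0 \<in> G" by blast
    have "K p0 \<inter> (\<Inter>p\<in>G. K p) \<noteq> {}"
    proof (rule compact_imp_fip_image)
      show "compact (K p0)"
        by (simp add: K_def split: prod.splits)
      show "closed (K p)" for p
        by (simp add: K_def split: prod.splits)
      fix F assume F: "finite F" "F \<subseteq> G"
      have "\<exists>x. \<forall>(z, y)\<in>insert p0 F. inner (z - x) (y + x) \<ge> 0"
        using F p0 by (intro finite_monotone_extension_at_negative mono) auto
      then obtain x where "\<And>p. p \<in> insert p0 F \<Longrightarrow> x \<in> K p"
        unfolding K[symmetric] by auto
      then show "K p0 \<inter> (\<Inter>p\<in>F. K p) \<noteq> {}"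
        by blast
    qed
    then show ?thesis by blast
  qed simp
  then obtain x where x: "\<And>p. p \<in> G \<Longrightarrow> x \<in> K p"
    by blast
  have "u - x \<in> A x"
  proof (rule maximally_monotoneD[OF assms])
    fix z y assume "y \<in> A z"
    then have "x \<in> K (z, y - u)"
      by (intro x) (auto simp: G_def)
    then show "inner (z - x) (y - (u - x)) \<ge> 0"
      by (simp add: K algebra_simps)
  qed
  then show ?thesis ..
qed

section \<open>Self-adjoint operators and their quadratic forms\<close>

text \<open>Expand the nonnegative number \<open>\<langle>T (v - s T v), v - s T v\<rangle>\<close> at \<open>s = 1 / C\<close>.\<close>

lemma norm_sq_le_of_psd:
  fixes T :: "'a::real_inner \<Rightarrow> 'a"
  assumes "linear T" and sym: "\<And>a b. inner (T a) b = inner a (T b)"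
    and psd: "\<And>a. inner (T a) a \<ge> 0"
    and bound: "\<And>a. inner (T a) a \<le> C * (norm a)\<^sup>2" and "C > 0"
  shows "(norm (T v))\<^sup>2 \<le> C * inner (T v) v"
proof -
  define s where "s = 1 / C"
  have "0 \<le> inner (T (v - s *\<^sub>R T v)) (v - s *\<^sub>R T v)"
    by (rule psd)
  also have "\<dots> = inner (T v) v - 2 * s * (norm (T v))\<^sup>2 + s * s * inner (T (T v)) (T v)"
    using sym[of "T v" v]
    by (simp add: linear_diff[OF assms(1)] linear_scale[OF assms(1)] power2_norm_eq_inner
        inner_diff_left inner_diff_right inner_commute algebra_simps)
  also have "\<dots> \<le> inner (T v) v - 2 * s * (norm (T v))\<^sup>2 + s * s * (C * (norm (T v))\<^sup>2)"
    by (intro add_left_mono mult_left_mono bound) auto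
  also have "\<dots> = inner (T v) v - (norm (T v))\<^sup>2 / C"
    using \<open>C > 0\<close> by (simp add: s_def field_simps)
  finally show ?thesis
    using \<open>C > 0\<close> by (simp add: field_simps)
qed

lemma psd_form_eq_0_imp_kernel:
  fixes T :: "'a::euclidean_space \<Rightarrow> 'a"
  assumes "linear T" and sym: "\<And>a b. inner (T a) b = inner a (T b)"
    and psd: "\<And>a. inner (T a) a \<ge> 0" and "inner (T v) v = 0"
  shows "T v = 0"
proof -
  obtain C where C: "C > 0" "\<And>a. norm (T a) \<le> C * norm a"
    using linear_bounded_pos[OF assms(1)] by blast
  have "inner (T a) a \<le> C * (norm a)\<^sup>2" for a
  proof -
    have "inner (T a) a \<le> norm (T a) * norm a"
      by (rule norm_cauchy_schwarz)
    also have "\<dots> \<le> (C * norm a) * norm a"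
      by (intro mult_right_mono C) auto
    finally show ?thesis by (simp add: power2_eq_square)
  qed
  from norm_sq_le_of_psd[OF assms(1-3) this C(1), of v] show ?thesis
    using assms(4) by simp
qed

text \<open>The Rayleigh quotient attains its minimum \<open>m\<close> on the compact unit sphere, and the form of
  \<open>W - m Id\<close> is then nonnegative and vanishes at the minimiser, which is therefore an eigenvector.
  In particular the set of eigenvalues has a least element.\<close>

lemma lambda_min_le_form:
  fixes W :: "'a::euclidean_space \<Rightarrow> 'a"
  assumes "linear W" and sym: "\<And>a b. inner (W a) b = inner a (W b)"
  shows "lambda_min W * (norm a)\<^sup>2 \<le> inner (W a) a"
proof -
  have "compact (sphere (0::'a) 1)"
    by simp
  moreover have "sphere (0::'a) 1 \<noteq> {}"
    using nonempty_Basis norm_Basis by fastforce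
  moreover have "continuous_on (sphere 0 1) (\<lambda>v. inner (W v) v)"
    by (intro continuous_on_inner linear_continuous_on continuous_on_id
        linear_conv_bounded_linear[THEN iffD1] assms(1))
  ultimately obtain v where v: "norm v = 1"
    and min: "\<And>w. norm w = 1 \<Longrightarrow> inner (W v) v \<le> inner (W w) w"
    using continuous_attains_inf[of "sphere 0 1" "\<lambda>v. inner (W v) v"] by auto
  define m where "m = inner (W v) v"
  have form: "m * (norm a)\<^sup>2 \<le> inner (W a) a" for a
  proof (cases "a = 0")
    case False
    have "m \<le> inner (W ((1 / norm a) *\<^sub>R a)) ((1 / norm a) *\<^sub>R a)"
      unfolding m_def using False by (intro min) simp
    also have "\<dots> = inner (W a) a / (norm a)\<^sup>2"
      by (simp add: linear_scale[OF assms(1)] power2_eq_square)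
    finally show ?thesis
      using False by (simp add: field_simps)
  qed (simp add: linear_0[OF assms(1)])
  define T where "T a = W a - m *\<^sub>R a" for a
  have "T v = 0"
  proof (rule psd_form_eq_0_imp_kernel[of T v])
    show "linear T"
      by (rule linearI)
        (simp_all add: T_def linear_add[OF assms(1)] linear_scale[OF assms(1)] algebra_simps)
    show "inner (T a) b = inner a (T b)" for a b
      by (simp add: T_def inner_diff_left inner_diff_right sym)
    show "inner (T a) a \<ge> 0" for a
      using form[of a] by (simp add: T_def inner_diff_left power2_norm_eq_inner)
    show "inner (T v) v = 0"
      using v by (simp add: T_def inner_diff_left m_def flip: power2_norm_eq_inner)
  qed
  then have "is_eigenvalue W m"
    using v unfolding is_eigenvalue_def T_def by (intro exI[of _ v]) auto
  moreover have "m \<le> l" if l: "is_eigenvalue W l" for l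
  proof -
    obtain w where "w \<noteq> 0" "W w = l *\<^sub>R w"
      using l by (auto simp: is_eigenvalue_def)
    then show ?thesis
      using form[of w] by (simp flip: power2_norm_eq_inner)
  qed
  ultimately have "lambda_min W = m"
    unfolding lambda_min_def by (rule Least_equality)
  then show ?thesis
    using form by simp
qed

text \<open>If \<open>z\<close> is the component of \<open>d\<close> orthogonal to \<open>range S\<close>, then \<open>S z = 0\<close>, so \<open>z\<close> is orthogonal
  both to \<open>d\<close> and to \<open>d - z\<close>.\<close>

lemma in_range_of_orthogonal_to_kernel:
  fixes S :: "'a::euclidean_space \<Rightarrow> 'a"
  assumes "linear S" and sym: "\<And>a b. inner (S a) b = inner a (S b)"
    and orth: "\<And>c. S c = 0 \<Longrightarrow> inner d c = 0"
  shows "d \<in> range S"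
proof -
  have sub: "span (range S) = range S"
    using linear_subspace_image[OF assms(1) subspace_UNIV] by simp
  obtain y z where yz: "y \<in> range S" "\<And>w. w \<in> range S \<Longrightarrow> orthogonal z w" "d = y + z"
    using orthogonal_subspace_decomp_exists[of "range S" d] unfolding sub by metis
  have "inner (S z) (S z) = 0"
    using yz(2)[of "S (S z)"] by (simp add: sym orthogonal_def)
  then have "inner d z = 0"
    by (intro orth) simp
  moreover have "inner z y = 0"
    using yz(2)[OF yz(1)] by (simp add: orthogonal_def)
  ultimately have "z = 0"
    by (simp add: yz(3) inner_add_left inner_commute[of y z])
  with yz show ?thesis by simp
qed

section \<open>Convergence of a reflected primal-dual iteration\<close>

text \<open>A primal-dual iteration with operators \<open>F + G\<close> and constraint \<open>S x = 0\<close>, in which the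
  dual term, usually \<open>S\<^sup>1\<^sup>/\<^sup>2 y\<close> for a dual variable \<open>y\<close>, is expressed through a vector \<open>r\<close> of which
  only \<open>S r\<close> matters, so that no square root of \<open>S\<close> has to be taken. The step length is absorbed into \<open>F\<close> and \<open>G\<close>. Truncated
  subtraction makes \<open>x (0 - 1)\<close> equal to \<open>x 0\<close>, which is the required initial condition
  \<open>x\<^sup>-\<^sup>1 = x\<^sup>0\<close>.\<close>

locale reflected_primal_dual =
  fixes F :: "'a::euclidean_space \<Rightarrow> 'a set" and G S :: "'a \<Rightarrow> 'a" and l \<mu> :: real
    and x r :: "nat \<Rightarrow> 'a"
  assumes mono_F: "monotone_operator F"
    and closed_F: "\<And>a b x w. \<lbrakk>a \<longlonglongrightarrow> x; b \<longlonglongrightarrow> w; \<And>j::nat. b j \<in> F (a j)\<rbrakk> \<Longrightarrow> w \<in> F x"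
    and mono_G: "monotone_operator (\<lambda>z. {G z})"
    and lip_G: "l-lipschitz_on UNIV G"
    and linear_S: "linear S"
    and sym_S: "\<And>a b. inner (S a) b = inner a (S b)"
    and psd_S: "\<And>a. inner (S a) a \<ge> 0"
    and coercive: "\<And>a. \<mu> * (norm a)\<^sup>2 \<le> inner (a - S a) a"
    and step_size: "2 * l < \<mu>"
    and step: "\<And>k. x k - S (r k + x k) - (2 *\<^sub>R G (x k) - G (x (k - 1))) - x (Suc k) \<in> F (x (Suc k))"
    and r_Suc: "\<And>k. r (Suc k) = r k + x (Suc k)"
begin

text \<open>These are the zeros of the monotone operator \<open>(x, r) \<mapsto> ((F + G) x + S r, - S x)\<close>, that is,
  the Kuhn-Tucker pairs of \<open>0 \<in> F x + G x\<close> plus the normal cone of \<open>ker S\<close> at \<open>x\<close>.\<close>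

definition saddle :: "'a \<Rightarrow> 'a \<Rightarrow> bool" where
  "saddle xs rs \<longleftrightarrow> S xs = 0 \<and> - S rs - G xs \<in> F xs"

text \<open>The first two terms are the squared distance to \<open>(xs, rs)\<close> in the metric in which
  the inclusion for \<open>F\<close> is a resolvent step. The last two carry over from one step to the next what the
  reflection \<open>2 G (x k) - G (x (k - 1))\<close> leaves uncompensated; they cost at most \<open>l\<close> times
  the squared distance of the first components.\<close>

definition lyapunov :: "'a \<Rightarrow> 'a \<Rightarrow> nat \<Rightarrow> real" where
  "lyapunov xs rs k = inner (x k - xs - S (x k - xs)) (x k - xs) + inner (S (r k - rs)) (r k - rs)
     - 2 * inner (G (x k) - G (x (k - 1))) (x k - xs) + l * (norm (x k - x (k - 1)))\<^sup>2"

lemmas S_diff = linear_diff[OF linear_S]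
lemmas S_add = linear_add[OF linear_S]

lemma l_nonneg: "l \<ge> 0"
  using lip_G by (rule lipschitz_on_nonneg)

lemma lipschitz_product_bound:
  "\<bar>2 * inner (G a - G b) c\<bar> \<le> l * (norm (a - b))\<^sup>2 + l * (norm c)\<^sup>2"
proof -
  have "\<bar>inner (G a - G b) c\<bar> \<le> norm (G a - G b) * norm c"
    by (rule Cauchy_Schwarz_ineq2)
  also have "\<dots> \<le> (l * norm (a - b)) * norm c"
    using lipschitz_onD[OF lip_G] by (intro mult_right_mono) (auto simp: dist_norm)
  finally have "\<bar>2 * inner (G a - G b) c\<bar> \<le> l * (2 * norm (a - b) * norm c)"
    by (simp add: abs_mult mult_ac)
  also have "\<dots> \<le> l * ((norm (a - b))\<^sup>2 + (norm c)\<^sup>2)"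
    using sum_squares_bound l_nonneg by (rule mult_left_mono)
  finally show ?thesis by (simp add: algebra_simps)
qed

lemma lyapunov_lower_bound:
  "(\<mu> - l) * (norm (x k - xs))\<^sup>2 + inner (S (r k - rs)) (r k - rs) \<le> lyapunov xs rs k"
  using coercive[of "x k - xs"] lipschitz_product_bound[of "x k" "x (k - 1)" "x k - xs"]
  unfolding lyapunov_def by (simp add: algebra_simps abs_le_iff)

lemma lyapunov_nonneg: "lyapunov xs rs k \<ge> 0"
proof -
  have "0 \<le> (\<mu> - l) * (norm (x k - xs))\<^sup>2 + inner (S (r k - rs)) (r k - rs)"
    using step_size l_nonneg by (intro add_nonneg_nonneg mult_nonneg_nonneg psd_S) auto
  also note lyapunov_lower_bound
  finally show ?thesis .
qed

text \<open>Monotonicity of \<open>F\<close> is applied to the new iterate and the saddle point. The resulting inner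
  product splits by polarisation into differences of squared distances, where
  \<open>r (Suc k) - r k = x (Suc k)\<close> and \<open>S xs = 0\<close> make the coupling terms cancel. Writing the
  reflected value as \<open>G (x (Suc k))\<close> minus the newest increment of \<open>G\<close> plus the previous one gives
  a term that monotonicity of \<open>G\<close> disposes of, a telescoping pair, and a product of two consecutive
  increments, which the Lipschitz bound charges to their squared lengths.\<close>

lemma lyapunov_decrease:
  assumes "saddle xs rs"
  shows "lyapunov xs rs (Suc k) + (\<mu> - 2 * l) * (norm (x (Suc k) - x k))\<^sup>2
           + inner (S (x (Suc k))) (x (Suc k)) \<le> lyapunov xs rs k"
proof -
  define a b p q where "a = x k - xs" and "b = x (Suc k) - xs"
    and "p = r k - rs" and "q = r (Suc k) - rs"
  define e where "e = x k - x (k - 1)"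
  define gp gk gn gs where "gp = G (x (k - 1))" and "gk = G (x k)"
    and "gn = G (x (Suc k))" and "gs = G xs"
  have Sxs: "S xs = 0"
    using assms by (simp add: saddle_def)
  have S_orth: "inner (S c) xs = 0" "inner xs (S c) = 0" for c
    by (simp_all add: sym_S Sxs flip: sym_S[of xs])
  have d: "x (Suc k) - x k = b - a"
    by (simp add: a_def b_def)
  have q: "q = p + b + xs"
    by (simp add: q_def p_def b_def r_Suc)
  have Sb: "S (x (Suc k)) = S b"
    by (simp add: b_def S_diff Sxs)
  have Sbb: "inner (S (x (Suc k))) (x (Suc k)) = inner (S b) b"
    unfolding Sb by (simp add: b_def inner_diff_right S_orth)
  have "0 \<le> inner (x (Suc k) - xs)
      (x k - S (r k + x k) - (2 *\<^sub>R gk - gp) - x (Suc k) - (- S rs - gs))"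
    unfolding gp_def gk_def gs_def using assms
    by (intro monotone_operatorD[OF mono_F] step) (simp add: saddle_def)
  also have "x k - S (r k + x k) - (2 *\<^sub>R gk - gp) - x (Suc k) - (- S rs - gs)
      = (a - b - S p - S a) - (2 *\<^sub>R gk - gp - gs)"
    by (simp add: a_def b_def p_def S_diff S_add Sxs)
  finally have "0 \<le> 2 * inner (a - b - S p - S a) b - 2 * inner (2 *\<^sub>R gk - gp - gs) b"
    by (simp add: b_def inner_commute inner_diff_left inner_diff_right)
  also have "2 * inner (a - b - S p - S a) b
      = inner (a - S a) a - inner (b - S b) b - inner (b - a - S (b - a)) (b - a)
        + inner (S p) p - inner (S q) q - inner (S b) b"
    using sym_S[of b a] sym_S[of b p]
    by (simp add: q S_diff S_add Sxs inner_diff_left inner_diff_right inner_add_left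
        inner_add_right S_orth inner_commute algebra_simps)
  also have "2 * inner (2 *\<^sub>R gk - gp - gs) b
      = 2 * inner (gk - gp) a + 2 * inner (gk - gp) (b - a)
        - 2 * inner (gn - gk) b + 2 * inner (gn - gs) b"
    by (simp add: inner_diff_left inner_diff_right)
  finally have main: "0 \<le> inner (a - S a) a - inner (b - S b) b - inner (b - a - S (b - a)) (b - a)
        + inner (S p) p - inner (S q) q - inner (S b) b
        - (2 * inner (gk - gp) a + 2 * inner (gk - gp) (b - a)
        - 2 * inner (gn - gk) b + 2 * inner (gn - gs) b)" .
  have "0 \<le> inner (gn - gs) b"
    using monotone_operatorD[OF mono_G, of "G (x (Suc k))" "x (Suc k)" "G xs" xs]
    by (simp add: gn_def gs_def b_def inner_commute)
  moreover have "- (2 * inner (gk - gp) (b - a)) \<le> l * (norm e)\<^sup>2 + l * (norm (b - a))\<^sup>2"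
    using lipschitz_product_bound[of "x k" "x (k - 1)" "b - a"]
    by (simp add: gk_def gp_def e_def abs_le_iff)
  moreover have "\<mu> * (norm (b - a))\<^sup>2 \<le> inner (b - a - S (b - a)) (b - a)"
    by (rule coercive)
  moreover have "lyapunov xs rs (Suc k) = inner (b - S b) b + inner (S q) q
      - 2 * inner (gn - gk) b + l * (norm (b - a))\<^sup>2"
    unfolding lyapunov_def diff_Suc_1 d
    by (simp add: b_def q_def gn_def gk_def)
  moreover have "lyapunov xs rs k = inner (a - S a) a + inner (S p) p
      - 2 * inner (gk - gp) a + l * (norm e)\<^sup>2"
    by (simp add: lyapunov_def a_def p_def gk_def gp_def e_def)
  ultimately show ?thesis
    using main unfolding d Sbb left_diff_distrib by linarith
qed

lemma decseq_lyapunov: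
  assumes "saddle xs rs"
  shows "decseq (lyapunov xs rs)"
proof (rule decseq_SucI)
  fix k
  have "0 \<le> (\<mu> - 2 * l) * (norm (x (Suc k) - x k))\<^sup>2"
    using step_size by simp
  with lyapunov_decrease[OF assms, of k] psd_S[of "x (Suc k)"]
  show "lyapunov xs rs (Suc k) \<le> lyapunov xs rs k"
    by linarith
qed

lemma S_form_le: "inner (S a) a \<le> (norm a)\<^sup>2"
proof -
  have "0 \<le> \<mu> * (norm a)\<^sup>2"
    using step_size l_nonneg by simp
  also have "\<dots> \<le> (norm a)\<^sup>2 - inner (S a) a"
    using coercive[of a] by (simp add: inner_diff_left power2_norm_eq_inner)
  finally show ?thesis by simp
qed

lemma norm_S_sq_le: "(norm (S a))\<^sup>2 \<le> inner (S a) a"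
  using norm_sq_le_of_psd[OF linear_S sym_S psd_S, of 1] S_form_le by simp

lemma tendsto_S: "f \<longlonglongrightarrow> c \<Longrightarrow> (\<lambda>j. S (f j)) \<longlonglongrightarrow> S c"
  using linear_S by (rule linear_conv_bounded_linear[THEN iffD1, THEN bounded_linear.tendsto])

lemma tendsto_G: "f \<longlonglongrightarrow> c \<Longrightarrow> (\<lambda>j. G (f j)) \<longlonglongrightarrow> G c"
  using lipschitz_on_continuous_on[OF lip_G]
  by (auto simp: continuous_on_eq_continuous_at intro: isCont_tendsto_compose)

text \<open>The decreases of the Lyapunov function, which is nonnegative and decreasing, tend to \<open>0\<close>.\<close>

lemma increments_tendsto_0:
  assumes "saddle xs rs"
  shows "(\<lambda>k. x (Suc k) - x k) \<longlonglongrightarrow> 0" and "(\<lambda>k. S (x k)) \<longlonglongrightarrow> 0"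
proof -
  obtain c where "lyapunov xs rs \<longlonglongrightarrow> c"
    using decseq_convergent[OF decseq_lyapunov[OF assms]] lyapunov_nonneg by metis
  from tendsto_diff[OF this LIMSEQ_Suc[OF this]]
  have gap: "(\<lambda>k. lyapunov xs rs k - lyapunov xs rs (Suc k)) \<longlonglongrightarrow> 0"
    by simp
  have nn: "0 \<le> (\<mu> - 2 * l) * (norm (x (Suc k) - x k))\<^sup>2" for k
    using step_size by simp
  have "(\<lambda>k. (\<mu> - 2 * l) * (norm (x (Suc k) - x k))\<^sup>2) \<longlonglongrightarrow> 0"
  proof (rule tendsto_sandwich[OF _ _ tendsto_const gap])
    show "\<forall>\<^sub>F k in sequentially. 0 \<le> (\<mu> - 2 * l) * (norm (x (Suc k) - x k))\<^sup>2"
      using nn by simp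
    have "(\<mu> - 2 * l) * (norm (x (Suc k) - x k))\<^sup>2
        \<le> lyapunov xs rs k - lyapunov xs rs (Suc k)" for k
      using lyapunov_decrease[OF assms, of k] psd_S[of "x (Suc k)"] by linarith
    then show "\<forall>\<^sub>F k in sequentially. (\<mu> - 2 * l) * (norm (x (Suc k) - x k))\<^sup>2
        \<le> lyapunov xs rs k - lyapunov xs rs (Suc k)"
      by simp
  qed
  from tendsto_mult_left[OF this, of "1 / (\<mu> - 2 * l)"]
  have "(\<lambda>k. (norm (x (Suc k) - x k))\<^sup>2) \<longlonglongrightarrow> 0"
    using step_size by simp
  then show "(\<lambda>k. x (Suc k) - x k) \<longlonglongrightarrow> 0"
    by (simp add: tendsto_norm_zero_iff)
  have "(\<lambda>k. (norm (S (x (Suc k))))\<^sup>2) \<longlonglongrightarrow> 0"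
  proof (rule tendsto_sandwich[OF _ _ tendsto_const gap])
    have "(norm (S (x (Suc k))))\<^sup>2 \<le> lyapunov xs rs k - lyapunov xs rs (Suc k)" for k
      using lyapunov_decrease[OF assms, of k] norm_S_sq_le[of "x (Suc k)"] nn[of k] by linarith
    then show "\<forall>\<^sub>F k in sequentially.
        (norm (S (x (Suc k))))\<^sup>2 \<le> lyapunov xs rs k - lyapunov xs rs (Suc k)"
      by simp
  qed simp
  then have "(\<lambda>k. S (x (Suc k))) \<longlonglongrightarrow> 0"
    by (simp add: tendsto_norm_zero_iff)
  then show "(\<lambda>k. S (x k)) \<longlonglongrightarrow> 0"
    by (rule LIMSEQ_imp_Suc)
qed

lemma backward_increments_tendsto_0:
  assumes "saddle xs rs"
  shows "(\<lambda>k. x k - x (k - 1)) \<longlonglongrightarrow> 0"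
  by (rule LIMSEQ_imp_Suc) (use increments_tendsto_0(1)[OF assms] in simp)

text \<open>The component of \<open>r k\<close> in \<open>ker S\<close> is invisible to the Lyapunov function and may be
  unbounded, so compactness is available for \<open>S (r k)\<close> only.\<close>

lemma bounded_iterates:
  assumes "saddle xs rs"
  shows "bounded (range (\<lambda>k. (x k, S (r k))))"
proof -
  define M where "M = lyapunov xs rs 0"
  have M: "(\<mu> - l) * (norm (x k - xs))\<^sup>2 + inner (S (r k - rs)) (r k - rs) \<le> M" for k
    using lyapunov_lower_bound[of k xs rs] decseqD[OF decseq_lyapunov[OF assms], of 0 k]
    by (simp add: M_def)
  have pos: "\<mu> - l > 0"
    using step_size l_nonneg by simp
  have "norm (x k) \<le> sqrt (M / (\<mu> - l)) + norm xs" for k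
  proof -
    have "(norm (x k - xs))\<^sup>2 \<le> M / (\<mu> - l)"
      using M[of k] psd_S[of "r k - rs"] pos by (simp add: field_simps)
    then have "norm (x k - xs) \<le> sqrt (M / (\<mu> - l))"
      by (rule real_le_rsqrt)
    then show ?thesis
      using norm_triangle_sub[of "x k" xs] by linarith
  qed
  then have "bounded (range x)"
    by (auto simp: bounded_iff)
  moreover have "norm (S (r k)) \<le> sqrt M + norm (S rs)" for k
  proof -
    have "0 \<le> (\<mu> - l) * (norm (x k - xs))\<^sup>2"
      using pos by simp
    then have "(norm (S (r k - rs)))\<^sup>2 \<le> M"
      using M[of k] norm_S_sq_le[of "r k - rs"] by linarith
    then have "norm (S (r k) - S rs) \<le> sqrt M"
      unfolding S_diff by (rule real_le_rsqrt)
    then show ?thesis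
      using norm_triangle_sub[of "S (r k)" "S rs"] by linarith
  qed
  then have "bounded (range (\<lambda>k. S (r k)))"
    by (auto simp: bounded_iff)
  ultimately have "bounded (range x \<times> range (\<lambda>k. S (r k)))"
    by (rule bounded_Times)
  then show ?thesis
    by (rule bounded_subset) auto
qed

text \<open>The form of \<open>S\<close> is a continuous function of \<open>S v\<close> alone: \<open>\<langle>S v, v\<rangle> = \<langle>S v, H (S v)\<rangle>\<close> for a
  linear right inverse \<open>H\<close> of \<open>S\<close> on its range.\<close>

lemma S_form_tendsto_0:
  assumes "(\<lambda>j. S (f j)) \<longlonglongrightarrow> S c"
  shows "(\<lambda>j. inner (S (f j - c)) (f j - c)) \<longlonglongrightarrow> 0"
proof -
  obtain H where H: "linear H" "\<And>w. w \<in> range S \<Longrightarrow> S (H w) = w"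
    using linear_exists_right_inverse_on[OF linear_S subspace_UNIV] by auto
  have form: "inner (S v) v = inner (S v) (H (S v))" for v
  proof -
    have "inner (S v) v = inner (S (H (S v))) v"
      by (simp add: H)
    also have "\<dots> = inner (S v) (H (S v))"
      by (simp add: sym_S inner_commute)
    finally show ?thesis .
  qed
  have "(\<lambda>j. S (f j - c)) \<longlonglongrightarrow> 0"
    using tendsto_diff[OF assms tendsto_const[of "S c"]] by (simp add: S_diff)
  moreover from this have "(\<lambda>j. H (S (f j - c))) \<longlonglongrightarrow> H 0"
    using H(1) by (intro bounded_linear.tendsto[of H])
      (simp_all add: linear_conv_bounded_linear)
  ultimately have "(\<lambda>j. inner (S (f j - c)) (H (S (f j - c)))) \<longlonglongrightarrow> inner 0 (H 0)"
    by (rule tendsto_inner)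
  then show ?thesis
    unfolding form[symmetric] by simp
qed

text \<open>A limit point of \<open>(x k, S (r k))\<close> gives a saddle point, since \<open>range S\<close> is closed and
  consecutive iterates approach each other. The Lyapunov function of that saddle point decreases and
  tends to \<open>0\<close> along the subsequence, hence along the whole sequence, and it dominates the squared
  distance of \<open>x k\<close> to the limit point.\<close>

theorem convergence:
  assumes "saddle xs rs"
  shows "\<exists>xb rb. saddle xb rb \<and> x \<longlonglongrightarrow> xb"
proof -
  obtain \<phi> lm where \<phi>: "strict_mono \<phi>"
    and lm: "((\<lambda>k. (x k, S (r k))) \<circ> \<phi>) \<longlonglongrightarrow> lm"
    using bounded_imp_convergent_subsequence[OF bounded_iterates[OF assms]] by metis
  define xb sb where "xb = fst lm" and "sb = snd lm"
  have x\<phi>: "(\<lambda>j. x (\<phi> j)) \<longlonglongrightarrow> xb" and s\<phi>: "(\<lambda>j. S (r (\<phi> j))) \<longlonglongrightarrow> sb"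
    using tendsto_fst[OF lm] tendsto_snd[OF lm] by (simp_all add: xb_def sb_def comp_def)
  have x\<phi>_Suc: "(\<lambda>j. x (Suc (\<phi> j))) \<longlonglongrightarrow> xb"
    using tendsto_add[OF LIMSEQ_subseq_LIMSEQ[OF increments_tendsto_0(1)[OF assms] \<phi>] x\<phi>]
    by (simp add: comp_def)
  have back_incr: "(\<lambda>j. x (\<phi> j) - x (\<phi> j - 1)) \<longlonglongrightarrow> 0"
    using LIMSEQ_subseq_LIMSEQ[OF backward_increments_tendsto_0[OF assms] \<phi>]
    by (simp add: comp_def)
  have x\<phi>_pred: "(\<lambda>j. x (\<phi> j - 1)) \<longlonglongrightarrow> xb"
    using tendsto_diff[OF x\<phi> back_incr] by simp
  have Sxb: "S xb = 0"
    using LIMSEQ_unique[OF tendsto_S[OF x\<phi>]]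
      LIMSEQ_subseq_LIMSEQ[OF increments_tendsto_0(2)[OF assms] \<phi>]
    by (simp add: comp_def)
  have "closed (range S)"
    by (intro closed_subspace linear_subspace_image linear_S subspace_UNIV)
  then have "sb \<in> range S"
    by (rule closed_sequentially[OF _ _ s\<phi>]) blast
  then obtain rb where rb: "sb = S rb" by blast
  have "- S rb - G xb \<in> F xb"
  proof (rule closed_F[OF x\<phi>_Suc])
    show "x (\<phi> j) - S (r (\<phi> j) + x (\<phi> j)) - (2 *\<^sub>R G (x (\<phi> j)) - G (x (\<phi> j - 1)))
        - x (Suc (\<phi> j)) \<in> F (x (Suc (\<phi> j)))" for j
      by (rule step)
    have "(\<lambda>j. x (\<phi> j) - (S (r (\<phi> j)) + S (x (\<phi> j)))
          - (2 *\<^sub>R G (x (\<phi> j)) - G (x (\<phi> j - 1))) - x (Suc (\<phi> j)))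
        \<longlonglongrightarrow> xb - (sb + S xb) - (2 *\<^sub>R G xb - G xb) - xb"
      by (intro tendsto_intros x\<phi> s\<phi> x\<phi>_Suc x\<phi>_pred tendsto_S tendsto_G)
    then show "(\<lambda>j. x (\<phi> j) - S (r (\<phi> j) + x (\<phi> j))
          - (2 *\<^sub>R G (x (\<phi> j)) - G (x (\<phi> j - 1))) - x (Suc (\<phi> j)))
        \<longlonglongrightarrow> - S rb - G xb"
      by (simp add: S_add Sxb rb scaleR_2)
  qed
  with Sxb have sad: "saddle xb rb"
    by (simp add: saddle_def)
  have "(\<lambda>j. lyapunov xb rb (\<phi> j))
      \<longlonglongrightarrow> inner (xb - xb - S (xb - xb)) (xb - xb) + 0 - 2 * inner (G xb - G xb) (xb - xb)
        + l * (norm (0::'a))\<^sup>2"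
    unfolding lyapunov_def
    by (intro tendsto_intros x\<phi> x\<phi>_pred back_incr tendsto_S tendsto_G S_form_tendsto_0 s\<phi>[unfolded rb])
  then have "(\<lambda>j. lyapunov xb rb (\<phi> j)) \<longlonglongrightarrow> 0"
    by simp
  moreover obtain c where c: "lyapunov xb rb \<longlonglongrightarrow> c"
    using decseq_convergent[OF decseq_lyapunov[OF sad]] lyapunov_nonneg by metis
  ultimately have "c = 0"
    using LIMSEQ_subseq_LIMSEQ[OF c \<phi>] LIMSEQ_unique by (fastforce simp: comp_def)
  have "(\<lambda>k. (norm (x k - xb))\<^sup>2) \<longlonglongrightarrow> 0"
  proof (rule tendsto_sandwich[OF _ _ tendsto_const])
    show "(\<lambda>k. lyapunov xb rb k / (\<mu> - l)) \<longlonglongrightarrow> 0"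
      using tendsto_divide[OF c[unfolded \<open>c = 0\<close>] tendsto_const[of "\<mu> - l"]] step_size l_nonneg
      by simp
    have "(norm (x k - xb))\<^sup>2 \<le> lyapunov xb rb k / (\<mu> - l)" for k
      using lyapunov_lower_bound[of k xb rb] psd_S[of "r k - rb"] step_size l_nonneg
      by (simp add: field_simps)
    then show "\<forall>\<^sub>F k in sequentially. (norm (x k - xb))\<^sup>2 \<le> lyapunov xb rb k / (\<mu> - l)"
      by simp
  qed simp
  then have "(\<lambda>k. x k - xb) \<longlonglongrightarrow> 0"
    by (simp add: tendsto_norm_zero_iff)
  then have "x \<longlonglongrightarrow> xb"
    by (rule LIM_zero_cancel)
  with sad show ?thesis by blast
qed

end

section \<open>Product operators and resolvents\<close>

text \<open>Two solutions \<open>x\<close> and \<open>x'\<close> of \<open>u - x \<in> A x\<close> satisfy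
  \<open>0 \<le> \<langle>x' - x, (u - x') - (u - x)\<rangle> = - \<parallel>x' - x\<parallel>\<^sup>2\<close>, so existence alone makes the resolvent well defined.\<close>

lemma resolvent_mem:
  fixes A :: "'a::real_inner \<Rightarrow> 'a set"
  assumes "monotone_operator A" and ex: "\<exists>x. u - x \<in> A x"
  shows "u - resolvent A u \<in> A (resolvent A u)"
proof -
  have eq: "inverse_operator (\<lambda>x. {x} + A x) u = {x. u - x \<in> A x}"
  proof -
    have "u \<in> {x} + A x \<longleftrightarrow> u - x \<in> A x" for x
      by (auto simp: set_plus_def algebra_simps intro: bexI[of _ "u - x"])
    then show ?thesis by (simp add: inverse_operator_def)
  qed
  obtain x where x: "u - x \<in> A x"
    using ex by blast
  have "x' = x" if "u - x' \<in> A x'" for x'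
  proof -
    have "0 \<le> inner (x' - x) ((u - x') - (u - x))"
      using assms(1) that x by (rule monotone_operatorD)
    also have "\<dots> = - inner (x' - x) (x' - x)"
      by (simp flip: inner_minus_right)
    finally have "inner (x' - x) (x' - x) \<le> 0"
      by simp
    then have "inner (x' - x) (x' - x) = 0"
      using inner_ge_zero[of "x' - x"] by (rule order.antisym)
    then show ?thesis by simp
  qed
  with x have "{x. u - x \<in> A x} = {x}" by blast
  then have "resolvent A u = x"
    by (simp add: resolvent_def eq)
  with x show ?thesis by simp
qed

lemma mem_scale_product_iff:
  "t \<noteq> 0 \<Longrightarrow>
    w \<in> scale_operator t (product_operator A) x \<longleftrightarrow> (\<forall>i. w $ i \<in> scale_operator t (A i) (x $ i))"
  by (simp add: mem_scale_operator_iff product_operator_def)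

lemma monotone_product_operator:
  fixes A :: "'n::finite \<Rightarrow> 'a::real_inner \<Rightarrow> 'a set"
  assumes "\<And>i. monotone_operator (A i)"
  shows "monotone_operator (product_operator A)"
  unfolding monotone_operator_def product_operator_def inner_vec_def
  by (auto intro!: sum_nonneg monotone_operatorD[OF assms])

lemma product_map_operator: "product_operator (\<lambda>i z. {B i z}) = (\<lambda>z. {product_map B z})"
  by (auto simp: product_operator_def product_map_def vec_eq_iff fun_eq_iff)

lemma monotone_product_map:
  fixes B :: "'n::finite \<Rightarrow> 'a::real_inner \<Rightarrow> 'a"
  assumes "\<And>i. monotone_operator (\<lambda>z. {B i z})"
  shows "monotone_operator (\<lambda>z. {product_map B z})"
  using monotone_product_operator[of "\<lambda>i z. {B i z}"] assms
  by (simp add: product_map_operator)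

lemma lipschitz_product_map:
  fixes B :: "'n::finite \<Rightarrow> 'a::real_normed_vector \<Rightarrow> 'a"
  assumes "\<And>i. L-lipschitz_on UNIV (B i)"
  shows "L-lipschitz_on UNIV (product_map B)"
proof (rule lipschitz_onI)
  show "L \<ge> 0"
    using assms lipschitz_on_nonneg by blast
  fix x y :: "'a ^ 'n"
  have "dist (product_map B x) (product_map B y)
      \<le> L2_set (\<lambda>i. L * dist (x $ i) (y $ i)) UNIV"
    unfolding dist_vec_def product_map_def
    using assms by (intro L2_set_mono) (auto intro: lipschitz_onD)
  also have "\<dots> = L * dist x y"
    using \<open>L \<ge> 0\<close> by (simp add: dist_vec_def L2_set_right_distrib)
  finally show "dist (product_map B x) (product_map B y) \<le> L * dist x y" .
qed

text \<open>A solution of \<open>u - x \<in> F x\<close> is assembled from the solutions that Minty's theorem provides in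
  each component.\<close>

lemma resolvent_product_mem:
  fixes A :: "'n::finite \<Rightarrow> 'a::euclidean_space \<Rightarrow> 'a set" and u :: "'a ^ 'n"
  assumes max: "\<And>i. maximally_monotone (A i)" and "t > 0"
  defines "F \<equiv> scale_operator t (product_operator A)"
  shows "u - resolvent F u \<in> F (resolvent F u)"
proof (rule resolvent_mem)
  have "monotone_operator (A i)" for i
    using max by (simp add: maximally_monotone_def)
  then show "monotone_operator F"
    unfolding F_def using \<open>t > 0\<close>
    by (intro monotone_operator_scale monotone_product_operator) auto
  have "\<forall>i. \<exists>c. u $ i - c \<in> scale_operator t (A i) c"
    using Minty[OF maximally_monotone_scale] max \<open>t > 0\<close> by blast
  then obtain c where "\<And>i. u $ i - c i \<in> scale_operator t (A i) (c i)"
    by metis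
  then have "u - (\<chi> i. c i) \<in> F (\<chi> i. c i)"
    using \<open>t > 0\<close> by (simp add: F_def mem_scale_product_iff)
  then show "\<exists>x. u - x \<in> F x" ..
qed

lemma closed_graph_scale_product:
  fixes A :: "'n::finite \<Rightarrow> 'a::euclidean_space \<Rightarrow> 'a set"
  assumes max: "\<And>i. maximally_monotone (A i)" and "t > 0"
    and lim: "a \<longlonglongrightarrow> x" "b \<longlonglongrightarrow> w"
    and mem: "\<And>j::nat. b j \<in> scale_operator t (product_operator A) (a j)"
  shows "w \<in> scale_operator t (product_operator A) x"
proof -
  have "w $ i \<in> scale_operator t (A i) (x $ i)" for i
    using maximally_monotone_scale[OF max \<open>t > 0\<close>]
      tendsto_vec_nth[OF lim(1)] tendsto_vec_nth[OF lim(2)]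
  proof (rule maximally_monotone_closed_graph)
    show "b j $ i \<in> scale_operator t (A i) (a j $ i)" for j
      using mem[of j] \<open>t > 0\<close> by (simp add: mem_scale_product_iff)
  qed
  then show ?thesis
    using \<open>t > 0\<close> by (simp add: mem_scale_product_iff)
qed

lemma solves_inclusion_iff:
  "solves_inclusion A B z \<longleftrightarrow> (\<exists>a. (\<forall>i. a i \<in> A i z) \<and> (\<Sum>i\<in>UNIV. a i + B i z) = 0)"
proof
  assume "solves_inclusion A B z"
  then obtain s where s: "\<And>i. s i \<in> A i z + {B i z}" "sum s UNIV = 0"
    unfolding solves_inclusion_def set_sum_alt[OF finite] by auto
  have "s i - B i z \<in> A i z" for i
    using s(1)[of i] by (auto simp: set_plus_def)
  with s(2) show "\<exists>a. (\<forall>i. a i \<in> A i z) \<and> (\<Sum>i\<in>UNIV. a i + B i z) = 0"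
    by (intro exI[of _ "\<lambda>i. s i - B i z"]) simp
next
  assume "\<exists>a. (\<forall>i. a i \<in> A i z) \<and> (\<Sum>i\<in>UNIV. a i + B i z) = 0"
  then obtain a where a: "\<And>i. a i \<in> A i z" "(\<Sum>i\<in>UNIV. a i + B i z) = 0"
    by blast
  have "a i + B i z \<in> A i z + {B i z}" for i
    using a(1) by (intro set_plus_intro) auto
  then have "\<exists>s. 0 = sum s UNIV \<and> (\<forall>i\<in>UNIV. s i \<in> A i z + {B i z})"
    using a(2) by (intro exI[of _ "\<lambda>i. a i + B i z"]) simp
  then show "solves_inclusion A B z"
    unfolding solves_inclusion_def set_sum_alt[OF finite] by blast
qed

lemma diagonal_eq: "diagonal = range (\<lambda>c. \<chi> i. c)"
proof (intro equalityI subsetI)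
  fix x :: "'a ^ 'b" assume "x \<in> diagonal"
  then have "x = (\<chi> i. x $ undefined)"
    by (auto simp: diagonal_def vec_eq_iff)
  then show "x \<in> range (\<lambda>c. \<chi> i. c)" by (rule range_eqI)
qed (auto simp: diagonal_def)

lemma inner_const_vec: "inner d (\<chi> i. c) = inner (\<Sum>i\<in>UNIV. d $ i) c"
  by (simp add: inner_vec_def inner_sum_left)

section \<open>Convergence of the distributed algorithm\<close>

theorem theorem4p3:
  fixes A :: "'n::finite \<Rightarrow> 'a::euclidean_space \<Rightarrow> 'a set"
    and B :: "'n \<Rightarrow> 'a \<Rightarrow> 'a"
    and W :: "'a ^ 'n \<Rightarrow> 'a ^ 'n"
    and L \<tau> :: real
    and x u v :: "int \<Rightarrow> 'a ^ 'n"
  assumes "L > 0"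
    and "\<And>i. maximally_monotone (A i)"
    and "\<And>i. monotone_operator (\<lambda>z. {B i z})"
    and "\<And>i. L-lipschitz_on UNIV (B i)"
    and "\<exists>z. solves_inclusion A B z"
    and "linear W"
    and "adjoint W = W"
    and "{z. z - W z = 0} = diagonal"
    and "positive_semidefinite (\<lambda>z. z - W z)"
    and "positive_definite (\<lambda>z. W z + z)"
    and "0 < \<tau>"
    and "\<tau> < (1 + lambda_min W) / (4 * L)"
    and "x 0 = x (-1)"
    and "\<And>k. k \<ge> 0 \<Longrightarrow> v k = 2 *\<^sub>R product_map B (x k) - product_map B (x (k - 1))"
    and "u 1 = x 0 - \<tau> *\<^sub>R product_map B (x 0)"
    and "x 1 = resolvent (scale_operator \<tau> (product_operator A)) (u 1)"
    and "\<And>k. k \<ge> 1 \<Longrightarrow>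
           u (k + 1) = W (x k) + u k - (1 / 2) *\<^sub>R (x (k - 1) + W (x (k - 1)))
                         - \<tau> *\<^sub>R (v k - v (k - 1))"
    and "\<And>k. k \<ge> 1 \<Longrightarrow>
           x (k + 1) = resolvent (scale_operator \<tau> (product_operator A)) (u (k + 1))"
  shows "\<exists>z. (\<lambda>k::nat. x (int k)) \<longlonglongrightarrow> (\<chi> i. z) \<and> solves_inclusion A B z"
proof -
  note L = \<open>L > 0\<close> and \<tau> = \<open>0 < \<tau>\<close>
  define F where "F = scale_operator \<tau> (product_operator A)"
  define G where "G z = \<tau> *\<^sub>R product_map B z" for z
  define S where "S z = (1 / 2) *\<^sub>R (z - W z)" for z
  define X where "X k = x (int k)" for k
  define r where "r k = (\<Sum>j=1..k. X j) - X 0" for k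
  have W_add: "W (a + b) = W a + W b" and W_scale: "W (c *\<^sub>R a) = c *\<^sub>R W a" for a b c
    using assms(6) by (simp_all add: linear_add linear_scale)
  have sym_W: "inner (W a) b = inner a (W b)" for a b
    using adjoint_works[OF assms(6), of b a] assms(7) by (simp add: inner_commute)
  have W_eq: "W a = a - 2 *\<^sub>R S a" for a
    by (simp add: S_def)
  have "a + W a = 2 *\<^sub>R (a - S a)" for a
    by (simp add: W_eq scaleR_2)
  then have W_half: "(1 / 2) *\<^sub>R (a + W a) = a - S a" for a
    by simp
  have linear_S: "linear S"
    by (rule linearI) (simp_all add: S_def W_add W_scale algebra_simps)
  have sym_S: "inner (S a) b = inner a (S b)" for a b
    by (simp add: S_def inner_diff_left inner_diff_right sym_W)
  have ker_S: "S a = 0 \<longleftrightarrow> a \<in> diagonal" for a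
    unfolding S_def assms(8)[symmetric] by simp
  have v: "\<tau> *\<^sub>R v (int k) = 2 *\<^sub>R G (X k) - G (X (k - 1))" for k
  proof -
    have "x (int k - 1) = X (k - 1)"
      using assms(13) by (cases k) (simp_all add: X_def)
    then show ?thesis
      by (simp add: assms(14) G_def X_def scaleR_diff_right mult.commute)
  qed
  have r_Suc: "r (Suc k) = r k + X (Suc k)" for k
    by (simp add: r_def)
  \<comment> \<open>Summing the recursion for \<open>u\<close>: beyond two consecutive iterates, the algorithm
    remembers only \<open>S (r k)\<close>. The offset
    \<open>- X 0\<close> in \<open>r\<close> makes the dual term vanish at \<open>k = 0\<close>, matching the first step.\<close>
  have u: "u (int k + 1) = X k - S (r k + X k) - \<tau> *\<^sub>R v (int k)" for k
  proof (induction k)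
    case 0
    have v0: "\<tau> *\<^sub>R v 0 = G (X 0)"
      using v[of 0] by (simp add: scaleR_2)
    have "S (r 0 + X 0) = 0"
      by (simp add: r_def linear_0[OF linear_S])
    then show ?case
      using assms(15) by (simp add: v0 X_def) (simp add: G_def)
  next
    case (Suc k)
    have "u (int (Suc k) + 1) = W (X (Suc k)) + u (int k + 1) - (1 / 2) *\<^sub>R (X k + W (X k))
        - \<tau> *\<^sub>R (v (int (Suc k)) - v (int k))"
      using assms(17)[of "int (Suc k)"] by (simp add: X_def add.commute)
    also have "(1 / 2) *\<^sub>R (X k + W (X k)) = X k - S (X k)"
      by (simp add: W_half)
    also have "W (X (Suc k)) = X (Suc k) - 2 *\<^sub>R S (X (Suc k))"
      by (rule W_eq)
    also have "X (Suc k) - 2 *\<^sub>R S (X (Suc k)) + u (int k + 1) - (X k - S (X k))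
          - \<tau> *\<^sub>R (v (int (Suc k)) - v (int k))
        = X (Suc k) - S (r (Suc k) + X (Suc k)) - \<tau> *\<^sub>R v (int (Suc k))"
      unfolding Suc r_Suc linear_add[OF linear_S] scaleR_2 scaleR_diff_right by simp
    finally show ?case .
  qed
  have X_Suc: "X (Suc k) = resolvent F (u (int k + 1))" for k
  proof -
    have "x (int k + 1) = resolvent F (u (int k + 1))"
      unfolding F_def using assms(16) assms(18)[of "int k"] by (cases "k = 0") auto
    then show ?thesis
      by (simp add: X_def add.commute)
  qed
  interpret reflected_primal_dual F G S "\<tau> * L" "(1 + lambda_min W) / 2" X r
  proof (rule reflected_primal_dual.intro)
    show "monotone_operator F"
      unfolding F_def using assms(2) \<tau>
      by (intro monotone_operator_scale monotone_product_operator) (auto simp: maximally_monotone_def)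
    show "w \<in> F y" if "a \<longlonglongrightarrow> y" "b \<longlonglongrightarrow> w" "\<And>j::nat. b j \<in> F (a j)" for a b y w
      using closed_graph_scale_product[of A, OF assms(2) \<tau>] that unfolding F_def by blast
    have "(\<lambda>z. {G z}) = scale_operator \<tau> (\<lambda>z. {product_map B z})"
      by (simp add: fun_eq_iff scale_operator_def G_def)
    moreover have "monotone_operator (scale_operator \<tau> (\<lambda>z. {product_map B z}))"
      using \<tau> by (intro monotone_operator_scale monotone_product_map assms(3)) simp
    ultimately show "monotone_operator (\<lambda>z. {G z})"
      by (simp only:)
    show "(\<tau> * L)-lipschitz_on UNIV G"
      using lipschitz_on_cmult[OF lipschitz_product_map[of L B, OF assms(4)], of \<tau>] \<tau>
      unfolding G_def by simp
    show "linear S" by (rule linear_S)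
    show "inner (S a) b = inner a (S b)" for a b by (rule sym_S)
    show "inner (S a) a \<ge> 0" for a
      using assms(9) by (simp add: S_def positive_semidefinite_def)
    show "(1 + lambda_min W) / 2 * (norm a)\<^sup>2 \<le> inner (a - S a) a" for a
    proof -
      have "inner (a - S a) a = ((norm a)\<^sup>2 + inner (W a) a) / 2"
        by (simp add: inner_add_left power2_norm_eq_inner flip: W_half)
      then show ?thesis
        using lambda_min_le_form[OF assms(6) sym_W, of a] by (simp add: ring_distribs)
    qed
    show "2 * (\<tau> * L) < (1 + lambda_min W) / 2"
      using assms(12) L by (simp add: field_simps)
    show "X k - S (r k + X k) - (2 *\<^sub>R G (X k) - G (X (k - 1))) - X (Suc k) \<in> F (X (Suc k))" for k
    proof -
      have "u (int k + 1) - X (Suc k) \<in> F (X (Suc k))"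
        unfolding X_Suc F_def by (rule resolvent_product_mem[of A, OF assms(2) \<tau>])
      then show ?thesis
        unfolding u v .
    qed
    show "r (Suc k) = r k + X (Suc k)" for k by (rule r_Suc)
  qed
  have mem_F: "w \<in> F y \<longleftrightarrow> (\<forall>i. (1 / \<tau>) *\<^sub>R w $ i \<in> A i (y $ i))" for w y
    using \<tau> by (simp add: F_def mem_scale_operator_iff product_operator_def)
  obtain zs where "solves_inclusion A B zs"
    using assms(5) by blast
  then obtain a where a: "\<And>i. a i \<in> A i zs" "(\<Sum>i\<in>UNIV. a i + B i zs) = 0"
    unfolding solves_inclusion_iff by blast
  \<comment> \<open>A dual certificate for the given solution: \<open>d\<close> is orthogonal to the diagonal, which is
    \<open>ker S\<close>, because its components sum to \<open>0\<close>.\<close>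
  define d where "d = (\<chi> i. - \<tau> *\<^sub>R (a i + B i zs))"
  have "(\<Sum>i\<in>UNIV. d $ i) = 0"
    using a(2) by (simp add: d_def sum_negf flip: scaleR_sum_right)
  then have "d \<in> range S"
    by (intro in_range_of_orthogonal_to_kernel linear_S sym_S)
      (auto simp: ker_S diagonal_eq inner_const_vec)
  then obtain rs where rs: "d = S rs" by blast
  have "saddle (\<chi> i. zs) rs"
    unfolding saddle_def
  proof
    show "S (\<chi> i. zs) = 0"
      by (simp add: ker_S diagonal_eq)
    show "- S rs - G (\<chi> i. zs) \<in> F (\<chi> i. zs)"
      using a(1) \<tau> by (simp add: mem_F d_def G_def product_map_def algebra_simps flip: rs)
  qed
  then obtain xb rb where xb: "saddle xb rb" "X \<longlonglongrightarrow> xb"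
    using convergence by blast
  then obtain z where z: "xb = (\<chi> i. z)"
    using ker_S[of xb] by (auto simp: saddle_def diagonal_eq)
  define w where "w = - S rb - G xb"
  \<comment> \<open>Conversely, vectors in \<open>range S\<close> are orthogonal to the diagonal, so the dual term of the limit
    disappears when its components are added up.\<close>
  have "inner (\<Sum>i\<in>UNIV. S rb $ i) c = 0" for c
  proof -
    have "inner (\<Sum>i\<in>UNIV. S rb $ i) c = inner rb (S (\<chi> i. c))"
      by (simp add: sym_S flip: inner_const_vec)
    also have "S (\<chi> i. c) = 0"
      by (simp add: ker_S diagonal_eq)
    finally show ?thesis by simp
  qed
  then have sum_S: "(\<Sum>i\<in>UNIV. S rb $ i) = 0"
    using inner_eq_zero_iff by blast
  have "solves_inclusion A B z"
    unfolding solves_inclusion_iff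
  proof (intro exI conjI allI)
    show "(1 / \<tau>) *\<^sub>R w $ i \<in> A i z" for i
      using xb(1) by (simp add: saddle_def mem_F z w_def)
    have "(1 / \<tau>) *\<^sub>R w $ i + B i z = - (1 / \<tau>) *\<^sub>R (S rb $ i)" for i
      using \<tau> by (simp add: w_def G_def z product_map_def algebra_simps)
    then show "(\<Sum>i\<in>UNIV. (1 / \<tau>) *\<^sub>R w $ i + B i z) = 0"
      using sum_S by (simp add: sum_negf flip: scaleR_sum_right)
  qed
  moreover have "(\<lambda>k::nat. x (int k)) \<longlonglongrightarrow> (\<chi> i. z)"
    using xb(2) by (simp add: z X_def[abs_def])
  ultimately show ?thesis by blast
qed

end
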